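(* Let $K$ and $J$ be forward kernels on $E=\mathbb{R}\times X$, let $\eta\in[0,\infty)$, and let $Q:\mathbb{R}\times\mathbb{R}\to[0,\infty)$ be super-additive, i.e. $Q(u,r)+Q(r,v)\le Q(u,v)$ for all $u<r<v$. Assume that for all $(s,x)\in E$ and all $A\in\mathcal{E}$, $$KJK(s,x,A)\le\int_A[\eta+Q(s,t)]\,K(s,x,dt\,dy).$$ Let $K_n=(KJ)^nK$ for $n=0,1,\ldots$, and $\widetilde K=\sum_{n=0}^\infty K_n$. Then for all $n=1,2,\ldots$ and $(s,x)\in E$, $$K_n(s,x,dt\,dy)\le K_{n-1}(s,x,dt\,dy)\left[\eta+\frac{Q(s,t)}{n}\right]\le K(s,x,dt\,dy)\prod_{l=1}^n\left[\eta+\frac{Q(s,t)}{l}\right].$$ If $0<\eta<1$, then for all $(s,x)\in E$, $$\widetilde K(s,x,dt\,dy)\le K(s,x,dt\,dy)\left(\frac{1}{1-\eta}\right)^{1+Q(s,t)/\eta}.$$ If $\eta=0$, then for all $(s,x)\in E$, $$\widetilde K(s,x,dt\,dy)\le K(s,x,dt\,dy)\,e^{Q(s,t)}.$$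
   Context: $(X,\mathcal{M})$ is a measurable space, $\mathbb{R}$ carries its Borel $\sigma$-algebra $\mathcal{B}_{\mathbb{R}}$, and $E=\mathbb{R}\times X$ carries the product $\sigma$-algebra $\mathcal{E}=\mathcal{B}_{\mathbb{R}}\times\mathcal{M}$. A kernel on $E$ is a map $K:E\times\mathcal{E}\to[0,\infty]$ such that $(s,x)\mapsto K(s,x,A)$ is $\mathcal{E}$-measurable for every $A\in\mathcal{E}$ and $A\mapsto K(s,x,A)$ is countably additive (a measure) for every $(s,x)\in E$. The composition of kernels $K,J$ is the kernel $KJ(s,x,A)=\int_E K(s,x,du\,dz)\,J(u,z,A)$. A kernel $K$ on $E$ is forward if for all $s\in\mathbb{R}$, $x\in X$, $A\in\mathcal{E}$: $K(s,x,A)=0$ whenever $A\subseteq(-\infty,s]\times X$. For measures $\mu,\nu$ on $E$ and a nonnegative function $f$ of $t$, the notation $\mu(dt\,dy)\le\nu(dt\,dy)f(t)$ means $\mu(A)\le\int_A f(t)\,\nu(dt\,dy)$ for all $A\in\mathcal{E}$. (By super-additivity, $t\mapsto Q(s,t)$ is nondecreasing on $(s,\infty)$, and $K(s,x,\cdot)$ vanishes on $(-\infty,s]\times X$, so only the values $Q(s,t)$ with $t>s$ matter.) *)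

theory Defs
  imports "HOL-Probability.Probability"
begin

text \<open>
  Kernels take values in \<open>[0,\<infinity>]\<close> and carry no finiteness condition, so the library's
  (sub)probability kernels do not apply. A kernel is a map from points to measures:
  \<open>K(z, A)\<close> is \<open>emeasure (K z) A\<close>. Values at points outside \<open>space E\<close> are irrelevant.
\<close>

definition kernel_on :: "'a measure \<Rightarrow> ('a \<Rightarrow> 'a measure) \<Rightarrow> bool" where
  "kernel_on E K \<longleftrightarrow>
     (\<forall>z\<in>space E. sets (K z) = sets E) \<and>
     (\<forall>A\<in>sets E. (\<lambda>z. emeasure (K z) A) \<in> borel_measurable E)"

definition kernel_comp ::
    "'a measure \<Rightarrow> ('a \<Rightarrow> 'a measure) \<Rightarrow> ('a \<Rightarrow> 'a measure) \<Rightarrow> 'a \<Rightarrow> 'a measure" where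
  "kernel_comp E K J z =
     measure_of (space E) (sets E) (\<lambda>A. \<integral>\<^sup>+ w. emeasure (J w) A \<partial>K z)"

text \<open>The zeroth power is the identity kernel, i.e. the Dirac measures \<open>return E z\<close>.\<close>

primrec kernel_power :: "'a measure \<Rightarrow> ('a \<Rightarrow> 'a measure) \<Rightarrow> nat \<Rightarrow> 'a \<Rightarrow> 'a measure" where
  "kernel_power E L 0 = return E"
| "kernel_power E L (Suc n) = kernel_comp E L (kernel_power E L n)"

definition kernel_suminf :: "'a measure \<Rightarrow> (nat \<Rightarrow> 'a \<Rightarrow> 'a measure) \<Rightarrow> 'a \<Rightarrow> 'a measure" where
  "kernel_suminf E L z = measure_of (space E) (sets E) (\<lambda>A. \<Sum>n. emeasure (L n z) A)"

text \<open>
  \<open>measure_of\<close> returns the null measure when its argument is not countably additive; the next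
  two lemmas show that this never happens for composition and summation of kernels.
\<close>

lemma emeasure_kernel_comp:
  assumes K: "kernel_on E K" and J: "kernel_on E J"
    and z: "z \<in> space E" and A: "A \<in> sets E"
  shows "emeasure (kernel_comp E K J z) A = (\<integral>\<^sup>+ w. emeasure (J w) A \<partial>K z)"
proof -
  let ?\<mu> = "\<lambda>A. \<integral>\<^sup>+ w. emeasure (J w) A \<partial>K z"
  have sK: "sets (K z) = sets E"
    using K z by (simp add: kernel_on_def)
  have sJ: "sets (J w) = sets E" if "w \<in> space (K z)" for w
    using J that sets_eq_imp_space_eq[OF sK] by (simp add: kernel_on_def)
  have mJ: "(\<lambda>w. emeasure (J w) B) \<in> borel_measurable (K z)" if "B \<in> sets E" for B
    using J that by (simp add: kernel_on_def measurable_cong_sets[OF sK refl])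
  have "countably_additive (sets E) ?\<mu>"
  proof (rule countably_additiveI)
    fix B :: "nat \<Rightarrow> 'a set"
    assume B: "range B \<subseteq> sets E" "disjoint_family B" "(\<Union>i. B i) \<in> sets E"
    have "(\<Sum>i. ?\<mu> (B i)) = (\<integral>\<^sup>+ w. (\<Sum>i. emeasure (J w) (B i)) \<partial>K z)"
      using B(1) by (intro nn_integral_suminf[symmetric] mJ) auto
    also have "\<dots> = ?\<mu> (\<Union>i. B i)"
      using B by (intro nn_integral_cong suminf_emeasure) (auto simp: sJ)
    finally show "(\<Sum>i. ?\<mu> (B i)) = ?\<mu> (\<Union>i. B i)" .
  qed
  then show ?thesis
    using A by (intro emeasure_measure_of[OF kernel_comp_def])
      (auto simp: positive_def kernel_comp_def sets.space_closed sets.sigma_sets_eq)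
qed

lemma emeasure_kernel_suminf:
  assumes L: "\<And>n. kernel_on E (L n)" and z: "z \<in> space E" and A: "A \<in> sets E"
  shows "emeasure (kernel_suminf E L z) A = (\<Sum>n. emeasure (L n z) A)"
proof -
  let ?\<mu> = "\<lambda>A. \<Sum>n. emeasure (L n z) A"
  have sL: "sets (L n z) = sets E" for n
    using L z by (simp add: kernel_on_def)
  have "countably_additive (sets E) ?\<mu>"
  proof (rule countably_additiveI)
    fix B :: "nat \<Rightarrow> 'a set"
    assume B: "range B \<subseteq> sets E" "disjoint_family B" "(\<Union>i. B i) \<in> sets E"
    have "(\<Sum>i. ?\<mu> (B i)) = (\<Sum>n. \<Sum>i. emeasure (L n z) (B i))"
      using nn_integral_suminf[of "\<lambda>i n. emeasure (L n z) (B i)" "count_space UNIV"]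
      by (simp add: nn_integral_count_space_nat)
    also have "\<dots> = ?\<mu> (\<Union>i. B i)"
      using B by (intro suminf_cong suminf_emeasure) (auto simp: sL)
    finally show "(\<Sum>i. ?\<mu> (B i)) = ?\<mu> (\<Union>i. B i)" .
  qed
  then show ?thesis
    using A by (intro emeasure_measure_of[OF kernel_suminf_def])
      (auto simp: positive_def kernel_suminf_def sets.space_closed sets.sigma_sets_eq)
qed

abbreviation spacetime :: "'x measure \<Rightarrow> (real \<times> 'x) measure" where
  "spacetime M \<equiv> borel \<Otimes>\<^sub>M M"

definition forward_kernel ::
    "'x measure \<Rightarrow> (real \<times> 'x \<Rightarrow> (real \<times> 'x) measure) \<Rightarrow> bool" where
  "forward_kernel M K \<longleftrightarrow>
     kernel_on (spacetime M) K \<and>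
     (\<forall>s. \<forall>x\<in>space M. \<forall>A\<in>sets (spacetime M).
        A \<subseteq> {..s} \<times> space M \<longrightarrow> emeasure (K (s, x)) A = 0)"

definition superadditive :: "(real \<Rightarrow> real \<Rightarrow> real) \<Rightarrow> bool" where
  "superadditive Q \<longleftrightarrow> (\<forall>u r v. u < r \<longrightarrow> r < v \<longrightarrow> Q u r + Q r v \<le> Q u v)"

text \<open>\<open>iter_kernel M K J n\<close> is \<open>K\<^sub>n = (KJ)\<^sup>n K\<close>.\<close>

definition iter_kernel ::
    "'x measure \<Rightarrow> (real \<times> 'x \<Rightarrow> (real \<times> 'x) measure) \<Rightarrow>
     (real \<times> 'x \<Rightarrow> (real \<times> 'x) measure) \<Rightarrow> nat \<Rightarrow> real \<times> 'x \<Rightarrow> (real \<times> 'x) measure" where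
  "iter_kernel M K J n =
     kernel_comp (spacetime M) (kernel_power (spacetime M) (kernel_comp (spacetime M) K J) n) K"

text \<open>
  \<open>weighted \<nu> f A\<close> is the integral of \<open>f(t) \<nu>(dt dy)\<close> over \<open>A\<close>. It is used with functions
  \<open>f\<close> built from \<open>Q s\<close> and measures \<open>\<nu>\<close> vanishing on \<open>{..s} \<times> X\<close>. Then \<open>f\<close> is monotone, hence
  Borel, on \<open>{s<..}\<close>, but it may fail to be measurable on \<open>{..s}\<close>. The integral
  \<open>nn_integral\<close>, being a supremum over simple functions below \<open>f\<close>, does not depend on the
  values of \<open>f\<close> on \<open>{..s}\<close> in this situation.
\<close>

definition weighted ::
    "(real \<times> 'x) measure \<Rightarrow> (real \<Rightarrow> real) \<Rightarrow> (real \<times> 'x) set \<Rightarrow> ennreal" where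
  "weighted \<nu> f A = (\<integral>\<^sup>+ w\<in>A. ennreal (f (fst w)) \<partial>\<nu>)"

end

theory Submission
  imports Defs
begin

text \<open>
  Assume \<open>K\<^sub>n\<^sub>+\<^sub>1 \<le> K\<^sub>n [\<eta> + Q(s,t)/(n+1)]\<close>. The next iterate can be split in two ways,
  \<open>K\<^sub>n\<^sub>+\<^sub>2 = K\<^sub>n\<^sub>+\<^sub>1 (JK) = K\<^sub>n J (KJK)\<close>. Let \<open>u\<close> be the time reached after \<open>K\<^sub>n\<close>. The induction
  hypothesis bounds the first form by weighting \<open>K\<^sub>n JK\<close> with \<open>\<eta> + Q(s,u)/(n+1)\<close>, and the bound
  for \<open>KJK\<close> gives the weight \<open>\<eta> + Q(u,t)\<close> for the second. Adding \<open>n+1\<close> times the first estimate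
  to the second and using \<open>Q(s,u) + Q(u,t) \<le> Q(s,t)\<close> yields
  \<open>(n+2) K\<^sub>n\<^sub>+\<^sub>2 \<le> K\<^sub>n\<^sub>+\<^sub>1 [(n+2) \<eta> + Q(s,t)]\<close>. Iterating gives the products, whose sum over \<open>n\<close> is
  the exponential series for \<open>\<eta> = 0\<close> and the binomial series of
  \<open>(1 - \<eta>)\<close> to the power \<open>-(1 + Q(s,t)/\<eta>)\<close> for \<open>0 < \<eta> < 1\<close>.
\<close>

section \<open>Integration against kernels and the algebra of composition\<close>

lemma kernel_onD:
  assumes "kernel_on E K"
  shows sets_kernel_on: "z \<in> space E \<Longrightarrow> sets (K z) = sets E"
    and space_kernel_on: "z \<in> space E \<Longrightarrow> space (K z) = space E"
    and measurable_emeasure_kernel_on: "A \<in> sets E \<Longrightarrow> (\<lambda>z. emeasure (K z) A) \<in> borel_measurable E"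
  using assms by (auto simp: kernel_on_def dest: sets_eq_imp_space_eq)

lemma measurable_kernel_on:
  assumes "kernel_on E K" "z \<in> space E" "f \<in> measurable E N"
  shows "f \<in> measurable (K z) N"
  using assms by (simp add: measurable_cong_sets[OF sets_kernel_on[OF assms(1,2)] refl])

lemma sets_kernel_comp [simp]: "sets (kernel_comp E K J z) = sets E"
  by (simp add: kernel_comp_def sets.space_closed sets.sigma_sets_eq)

text \<open>Induction over nonnegative Borel functions: indicators are the measurability clause of
  \<open>kernel_on\<close>, and monotone limits pass through the integral. No finiteness of the
  measures \<open>K z\<close> enters.\<close>

lemma measurable_nn_integral_kernel:
  assumes K: "kernel_on E K" and f: "f \<in> borel_measurable E"
  shows "(\<lambda>z. \<integral>\<^sup>+ w. f w \<partial>K z) \<in> borel_measurable E"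
  using f
proof induct
  case (cong f g)
  then have "(\<lambda>z. \<integral>\<^sup>+ w. f w \<partial>K z) \<in> borel_measurable E
      \<longleftrightarrow> (\<lambda>z. \<integral>\<^sup>+ w. g w \<partial>K z) \<in> borel_measurable E"
    by (intro measurable_cong nn_integral_cong) (auto simp: space_kernel_on[OF K])
  then show ?case using cong by simp
next
  case (set B)
  then have "(\<lambda>z. \<integral>\<^sup>+ w. indicator B w \<partial>K z) \<in> borel_measurable E
      \<longleftrightarrow> (\<lambda>z. emeasure (K z) B) \<in> borel_measurable E"
    by (intro measurable_cong nn_integral_indicator) (auto simp: sets_kernel_on[OF K])
  then show ?case using set measurable_emeasure_kernel_on[OF K] by simp
next
  case (mult f c)
  then have "(\<lambda>z. \<integral>\<^sup>+ w. c * f w \<partial>K z) \<in> borel_measurable E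
      \<longleftrightarrow> (\<lambda>z. c * (\<integral>\<^sup>+ w. f w \<partial>K z)) \<in> borel_measurable E"
    by (intro measurable_cong nn_integral_cmult measurable_kernel_on[OF K])
  then show ?case using mult by simp
next
  case (add f g)
  then have "(\<lambda>z. \<integral>\<^sup>+ w. g w + f w \<partial>K z) \<in> borel_measurable E
      \<longleftrightarrow> (\<lambda>z. (\<integral>\<^sup>+ w. g w \<partial>K z) + (\<integral>\<^sup>+ w. f w \<partial>K z)) \<in> borel_measurable E"
    by (intro measurable_cong nn_integral_add measurable_kernel_on[OF K])
  then show ?case using add by simp
next
  case (seq U)
  then have "(\<lambda>z. \<integral>\<^sup>+ w. (SUP i. U i) w \<partial>K z) \<in> borel_measurable E
      \<longleftrightarrow> (\<lambda>z. SUP i. \<integral>\<^sup>+ w. U i w \<partial>K z) \<in> borel_measurable E"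
    unfolding SUP_apply
    by (intro measurable_cong nn_integral_monotone_convergence_SUP measurable_kernel_on[OF K])
  then show ?case using seq by simp
qed

lemma kernel_on_comp:
  assumes K: "kernel_on E K" and J: "kernel_on E J"
  shows "kernel_on E (kernel_comp E K J)"
  unfolding kernel_on_def
proof (intro conjI ballI)
  fix A assume A: "A \<in> sets E"
  have "(\<lambda>z. \<integral>\<^sup>+ w. emeasure (J w) A \<partial>K z) \<in> borel_measurable E"
    by (intro measurable_nn_integral_kernel[OF K] measurable_emeasure_kernel_on[OF J] A)
  then show "(\<lambda>z. emeasure (kernel_comp E K J z) A) \<in> borel_measurable E"
    by (subst measurable_cong[OF emeasure_kernel_comp[OF K J _ A]])
qed simp

lemma kernel_on_return: "kernel_on E (return E)"
  by (auto simp: kernel_on_def emeasure_return cong: measurable_cong)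

lemma kernel_on_power: "kernel_on E L \<Longrightarrow> kernel_on E (kernel_power E L n)"
  by (induction n) (auto intro: kernel_on_comp kernel_on_return)

text \<open>For indicators this is the formula defining composition; linearity and monotone
  convergence extend it. Unlike a Fubini argument, it never exchanges the order of integration, so
  arbitrary measures are allowed.\<close>

lemma nn_integral_kernel_comp:
  assumes K: "kernel_on E K" and J: "kernel_on E J"
    and z: "z \<in> space E" and f: "f \<in> borel_measurable E"
  shows "(\<integral>\<^sup>+ v. f v \<partial>kernel_comp E K J z) = (\<integral>\<^sup>+ w. \<integral>\<^sup>+ v. f v \<partial>J w \<partial>K z)"
proof -
  note KJ = kernel_on_comp[OF K J]
  note meas = measurable_kernel_on[OF K z] measurable_kernel_on[OF KJ z]
    measurable_nn_integral_kernel[OF J]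
  have [simp]: "space (kernel_comp E K J z) = space E" "space (K z) = space E"
    using z KJ K by (simp_all add: space_kernel_on)
  show ?thesis
    using f
  proof induct
    case (cong f g)
    have "(\<integral>\<^sup>+ v. f v \<partial>kernel_comp E K J z) = (\<integral>\<^sup>+ v. g v \<partial>kernel_comp E K J z)"
      using cong by (intro nn_integral_cong) simp
    moreover have "(\<integral>\<^sup>+ w. \<integral>\<^sup>+ v. f v \<partial>J w \<partial>K z) = (\<integral>\<^sup>+ w. \<integral>\<^sup>+ v. g v \<partial>J w \<partial>K z)"
      using cong by (intro nn_integral_cong) (simp add: space_kernel_on[OF J])
    ultimately show ?case using cong by simp
  next
    case (set B)
    have "(\<integral>\<^sup>+ w. \<integral>\<^sup>+ v. indicator B v \<partial>J w \<partial>K z) = (\<integral>\<^sup>+ w. emeasure (J w) B \<partial>K z)"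
      using set by (intro nn_integral_cong nn_integral_indicator) (simp add: sets_kernel_on[OF J])
    then show ?case using set by (simp add: emeasure_kernel_comp[OF K J z])
  next
    case (mult f c)
    have "(\<integral>\<^sup>+ w. \<integral>\<^sup>+ v. c * f v \<partial>J w \<partial>K z) = (\<integral>\<^sup>+ w. c * (\<integral>\<^sup>+ v. f v \<partial>J w) \<partial>K z)"
      using mult by (intro nn_integral_cong nn_integral_cmult measurable_kernel_on[OF J]) auto
    then show ?case using mult by (simp add: nn_integral_cmult meas)
  next
    case (add f g)
    have "(\<integral>\<^sup>+ w. \<integral>\<^sup>+ v. g v + f v \<partial>J w \<partial>K z)
        = (\<integral>\<^sup>+ w. (\<integral>\<^sup>+ v. g v \<partial>J w) + (\<integral>\<^sup>+ v. f v \<partial>J w) \<partial>K z)"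
      using add by (intro nn_integral_cong nn_integral_add measurable_kernel_on[OF J]) auto
    then show ?case using add by (simp add: nn_integral_add meas)
  next
    case (seq U)
    have "(\<integral>\<^sup>+ w. \<integral>\<^sup>+ v. (SUP i. U i v) \<partial>J w \<partial>K z)
        = (\<integral>\<^sup>+ w. (SUP i. \<integral>\<^sup>+ v. U i v \<partial>J w) \<partial>K z)"
      using seq
      by (intro nn_integral_cong nn_integral_monotone_convergence_SUP measurable_kernel_on[OF J]) auto
    also have "\<dots> = (SUP i. \<integral>\<^sup>+ w. \<integral>\<^sup>+ v. U i v \<partial>J w \<partial>K z)"
      using seq by (intro nn_integral_monotone_convergence_SUP meas)
        (auto simp: incseq_def le_fun_def intro!: nn_integral_mono)
    finally show ?case
      using seq by (simp add: image_comp nn_integral_monotone_convergence_SUP meas)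
  qed
qed

text \<open>Kernel identities hold only at points of \<open>space E\<close>, so factors cannot be
  rewritten as functions. Replacing the right factor pointwise suffices because \<open>K z\<close>
  only sees points of \<open>space E\<close>.\<close>

lemma kernel_comp_cong:
  assumes "K z = K' z" "space (K z) = space E" "\<And>w. w \<in> space E \<Longrightarrow> J w = J' w"
  shows "kernel_comp E K J z = kernel_comp E K' J' z"
proof -
  have "(\<integral>\<^sup>+ w. emeasure (J w) A \<partial>K z) = (\<integral>\<^sup>+ w. emeasure (J' w) A \<partial>K' z)" for A
    unfolding assms(1)[symmetric] using assms(2,3) by (intro nn_integral_cong) simp
  then show ?thesis by (simp add: kernel_comp_def)
qed

text \<open>On a set A both sides reduce to the same iterated integral of
  \<open>emeasure (L v) A\<close>, first over \<open>J w\<close> and then over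
  \<open>K z\<close>.\<close>

lemma kernel_comp_assoc:
  assumes K: "kernel_on E K" and J: "kernel_on E J" and L: "kernel_on E L"
    and z: "z \<in> space E"
  shows "kernel_comp E (kernel_comp E K J) L z = kernel_comp E K (kernel_comp E J L) z"
proof (rule measure_eqI)
  fix A assume "A \<in> sets (kernel_comp E (kernel_comp E K J) L z)"
  then have A: "A \<in> sets E" by simp
  note KJ = kernel_on_comp[OF K J] and JL = kernel_on_comp[OF J L]
  have "emeasure (kernel_comp E (kernel_comp E K J) L z) A
      = (\<integral>\<^sup>+ w. \<integral>\<^sup>+ v. emeasure (L v) A \<partial>J w \<partial>K z)"
    by (simp add: emeasure_kernel_comp[OF KJ L z A]
        nn_integral_kernel_comp[OF K J z measurable_emeasure_kernel_on[OF L A]])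
  also have "\<dots> = (\<integral>\<^sup>+ w. emeasure (kernel_comp E J L w) A \<partial>K z)"
    by (intro nn_integral_cong) (simp add: emeasure_kernel_comp[OF J L _ A] space_kernel_on[OF K z])
  also have "\<dots> = emeasure (kernel_comp E K (kernel_comp E J L) z) A"
    by (simp add: emeasure_kernel_comp[OF K JL z A])
  finally show "emeasure (kernel_comp E (kernel_comp E K J) L z) A
      = emeasure (kernel_comp E K (kernel_comp E J L) z) A" .
qed simp

lemma kernel_comp_return_left:
  assumes K: "kernel_on E K" and z: "z \<in> space E"
  shows "kernel_comp E (return E) K z = K z"
  by (rule measure_eqI)
    (simp_all add: sets_kernel_on[OF K z] emeasure_kernel_comp[OF kernel_on_return K z]
      nn_integral_return[OF z] measurable_emeasure_kernel_on[OF K])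

lemma kernel_comp_return_right:
  assumes K: "kernel_on E K" and z: "z \<in> space E"
  shows "kernel_comp E K (return E) z = K z"
  by (rule measure_eqI)
    (simp_all add: sets_kernel_on[OF K z] emeasure_kernel_comp[OF K kernel_on_return z])

text \<open>The recursion splits off a factor on the left; the iterates will be extended on the
  right, next to the final \<open>K\<close>.\<close>

lemma kernel_power_Suc2:
  assumes L: "kernel_on E L" and z: "z \<in> space E"
  shows "kernel_power E L (Suc n) z = kernel_comp E (kernel_power E L n) L z"
  using z
proof (induction n arbitrary: z)
  case 0
  then show ?case by (simp add: kernel_comp_return_left kernel_comp_return_right L)
next
  case (Suc n)
  have "kernel_power E L (Suc (Suc n)) z
      = kernel_comp E L (kernel_comp E (kernel_power E L n) L) z"
    unfolding kernel_power.simps(2)[of E L "Suc n"]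
    using Suc by (intro kernel_comp_cong) (simp_all add: space_kernel_on[OF L] del: kernel_power.simps)
  also have "\<dots> = kernel_comp E (kernel_power E L (Suc n)) L z"
    using Suc by (simp add: kernel_comp_assoc kernel_on_power L)
  finally show ?case .
qed

section \<open>Forward kernels and comparison of weighted measures\<close>

lemma forward_kernel_imp_kernel_on: "forward_kernel M K \<Longrightarrow> kernel_on (spacetime M) K"
  by (simp add: forward_kernel_def)

text \<open>The past \<open>{..fst z} \<times> space M\<close> is itself a null set. In this
  almost-everywhere form the order of times enters all later integral estimates.\<close>

lemma AE_forward_kernel:
  assumes "forward_kernel M K" "z \<in> space (spacetime M)"
  shows "AE w in K z. fst z < fst w"
proof (rule AE_I')
  obtain s x where z: "z = (s, x)" and x: "x \<in> space M"
    using assms(2) by (auto simp: space_pair_measure)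
  have "kernel_on (spacetime M) K"
    using assms(1) by (rule forward_kernel_imp_kernel_on)
  note [simp] = sets_kernel_on[OF this assms(2), unfolded z] space_kernel_on[OF this assms(2), unfolded z]
  show "{..fst z} \<times> space M \<in> null_sets (K z)"
    using assms(1) x by (auto simp: forward_kernel_def null_sets_def z)
  show "{w \<in> space (K z). \<not> fst z < fst w} \<subseteq> {..fst z} \<times> space M"
    by (auto simp: space_pair_measure z)
qed

text \<open>Almost every intermediate point has a time u > s, so a set lying before s also lies
  before u and the second kernel gives it measure 0.\<close>

lemma forward_kernel_comp:
  assumes K: "forward_kernel M K" and J: "forward_kernel M J"
  shows "forward_kernel M (kernel_comp (spacetime M) K J)"
  unfolding forward_kernel_def
proof (intro conjI allI ballI impI)
  note K' = forward_kernel_imp_kernel_on[OF K] and J' = forward_kernel_imp_kernel_on[OF J]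
  show "kernel_on (spacetime M) (kernel_comp (spacetime M) K J)"
    by (rule kernel_on_comp[OF K' J'])
  fix s x A
  assume x: "x \<in> space M" and A: "A \<in> sets (spacetime M)" "A \<subseteq> {..s} \<times> space M"
  have z: "(s, x) \<in> space (spacetime M)"
    using x by (simp add: space_pair_measure)
  have "AE w in K (s, x). emeasure (J w) A = 0"
    using AE_forward_kernel[OF K z] AE_space
  proof eventually_elim
    case (elim w)
    then obtain u y where w: "w = (u, y)" "y \<in> space M" "s < u"
      by (auto simp: space_kernel_on[OF K' z] space_pair_measure)
    then have "A \<subseteq> {..u} \<times> space M"
      using A(2) by fastforce
    then show ?case
      using J A(1) w by (simp add: forward_kernel_def)
  qed
  then have "(\<integral>\<^sup>+ w. emeasure (J w) A \<partial>K (s, x)) = (\<integral>\<^sup>+ w. 0 \<partial>K (s, x))"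
    by (rule nn_integral_cong_AE)
  then show "emeasure (kernel_comp (spacetime M) K J (s, x)) A = 0"
    by (simp add: emeasure_kernel_comp[OF K' J' z A(1)])
qed

text \<open>The setwise bounds say that \<mu> is at most the measure with density f(t) with respect
  to \<nu>, and integrals are monotone in the measure. Since f must be Borel on the whole line, this
  is applied to the truncation of Q introduced below.\<close>

lemma nn_integral_le_of_weighted:
  assumes \<mu>: "sets \<mu> = sets (spacetime M)" and \<nu>: "sets \<nu> = sets (spacetime M)"
    and f: "f \<in> borel_measurable borel" and g: "g \<in> borel_measurable (spacetime M)"
    and le: "\<And>A. A \<in> sets (spacetime M) \<Longrightarrow> emeasure \<mu> A \<le> weighted \<nu> f A"
  shows "(\<integral>\<^sup>+ w. g w \<partial>\<mu>) \<le> (\<integral>\<^sup>+ w. ennreal (f (fst w)) * g w \<partial>\<nu>)"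
proof -
  have f': "(\<lambda>w. ennreal (f (fst w))) \<in> borel_measurable \<nu>"
    using f by (simp add: measurable_cong_sets[OF \<nu> refl])
  have "\<mu> \<le> density \<nu> (\<lambda>w. ennreal (f (fst w)))"
    using le f' by (subst le_measure) (auto simp: \<mu> \<nu> emeasure_density weighted_def)
  then have "(\<integral>\<^sup>+ w. g w \<partial>\<mu>) \<le> (\<integral>\<^sup>+ w. g w \<partial>density \<nu> (\<lambda>w. ennreal (f (fst w))))"
    by (intro nn_integral_mono_measure) (simp_all add: \<mu> \<nu>)
  also have "\<dots> = (\<integral>\<^sup>+ w. ennreal (f (fst w)) * g w \<partial>\<nu>)"
    using f' g by (intro nn_integral_density) (simp_all add: measurable_cong_sets[OF \<nu> refl])
  finally show ?thesis .
qed

text \<open>Clears the denominator m in the weights. The factor c may be infinite, so the arithmetic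
  is done on the finite factors alone.\<close>

lemma ennreal_mult_add_divide:
  assumes "0 < m" "0 \<le> a" "0 \<le> b"
  shows "ennreal m * (ennreal (a + b / m) * c) = ennreal (m * a + b) * c"
proof -
  have "ennreal m * ennreal (a + b / m) = ennreal (m * (a + b / m))"
    using assms by (intro ennreal_mult[symmetric]) simp_all
  also have "m * (a + b / m) = m * a + b"
    using assms by (simp add: distrib_left)
  finally show ?thesis
    by (simp only: mult.assoc[symmetric])
qed

section \<open>The exponential and binomial series\<close>

lemma sums_prod_div_exp: "(\<lambda>n. \<Prod>l=1..n. y / real l) sums exp y"
proof -
  have "(\<Prod>l=1..n. y / real l) = y ^ n /\<^sub>R fact n" for n
    by (simp add: prod_dividef fact_prod) (simp add: divide_inverse_commute)
  then show ?thesis using exp_converges[of y] by simp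
qed

lemma sums_prod_div_powr:
  fixes \<eta> y :: real
  assumes "0 < \<eta>" "\<eta> < 1"
  shows "(\<lambda>n. \<Prod>l=1..n. \<eta> + y / real l) sums (1 / (1 - \<eta>)) powr (1 + y / \<eta>)"
proof -
  \<comment> \<open>This a satisfies (a + n) \<eta> / (n + 1) = \<eta> + y / (n + 1), so the ratio
    of consecutive binomial terms is exactly the next factor of the product.\<close>
  define a where "a = 1 + y / \<eta>"
  have "(\<Prod>l=1..n. \<eta> + y / real l) = (- a gchoose n) * (- \<eta>) ^ n" for n
  proof (induction n)
    case (Suc n)
    have "(- a gchoose Suc n) = (- a gchoose n) * (- a - real n) / real (Suc n)"
      by (simp add: gbinomial_pochhammer pochhammer_Suc field_simps)
    then have "(- a gchoose Suc n) * (- \<eta>) ^ Suc n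
        = (- a gchoose n) * (- \<eta>) ^ n * ((a + real n) * \<eta> / real (Suc n))"
      by (simp only:) (simp add: field_simps)
    moreover have "(a + real n) * \<eta> = (\<eta> + y / real (Suc n)) * real (Suc n)"
      using assms by (simp add: a_def distrib_right) (simp add: distrib_left)
    ultimately show ?case
      using Suc by simp
  qed simp
  moreover have "(\<lambda>n. (- a gchoose n) * (- \<eta>) ^ n) sums (1 + - \<eta>) powr - a"
    using assms by (intro gen_binomial_real) simp
  ultimately show ?thesis
    unfolding a_def[symmetric] using assms by (simp add: powr_minus_divide powr_divide)
qed

section \<open>The perturbation setting and the truncation of Q\<close>

locale kernel_perturbation =
  fixes M :: "'x measure"
    and K J :: "real \<times> 'x \<Rightarrow> (real \<times> 'x) measure"
    and \<eta> :: real
    and Q :: "real \<Rightarrow> real \<Rightarrow> real"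
  assumes forward_K: "forward_kernel M K" and forward_J: "forward_kernel M J"
    and \<eta>_nonneg: "0 \<le> \<eta>"
    and Q_nonneg: "\<And>u v. 0 \<le> Q u v" and Q_superadditive: "superadditive Q"
    and KJK_le: "\<And>s x A. x \<in> space M \<Longrightarrow> A \<in> sets (spacetime M) \<Longrightarrow>
           emeasure (kernel_comp (spacetime M) (kernel_comp (spacetime M) K J) K (s, x)) A
             \<le> weighted (K (s, x)) (\<lambda>t. \<eta> + Q s t) A"
begin

abbreviation "E \<equiv> spacetime M"
abbreviation "JK \<equiv> kernel_comp E J K"
abbreviation "KJK \<equiv> kernel_comp E (kernel_comp E K J) K"
abbreviation "K\<^sub>i \<equiv> iter_kernel M K J"

text \<open>Unlike \<open>Q s\<close>, the truncation is monotone on the whole line and hence Borel.\<close>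

definition q :: "real \<Rightarrow> real \<Rightarrow> real" where
  "q s t = (if s < t then Q s t else 0)"

lemma q_nonneg: "0 \<le> q s t"
  by (simp add: q_def Q_nonneg)

lemma q_superadditive: "u < r \<Longrightarrow> r < v \<Longrightarrow> q u r + q r v \<le> q u v"
  using Q_superadditive by (auto simp: q_def superadditive_def)

lemma measurable_q [measurable]: "q s \<in> borel_measurable borel"
proof (rule borel_measurable_mono, rule monoI)
  fix t t' :: real
  assume "t \<le> t'"
  \<comment> \<open>For s < t < t', super-additivity and \<open>0 \<le> q t t'\<close> give
    monotonicity; if s < t fails, the left side is 0.\<close>
  then show "q s t \<le> q s t'"
    using q_superadditive[of s t t'] q_nonneg[of t t'] q_nonneg[of s t']
    by (cases "s < t"; cases "t = t'") (auto simp: q_def)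
qed

text \<open>Passes between Q and its truncation. The integrands agree almost everywhere, which
  suffices even when \<open>Q s\<close> is not measurable on the past of s.\<close>

lemma weighted_q:
  assumes "AE w in \<nu>. s < fst w"
  shows "weighted \<nu> (\<lambda>t. F (q s t)) A = weighted \<nu> (\<lambda>t. F (Q s t)) A"
  unfolding weighted_def
  by (rule nn_integral_cong_AE, use assms in eventually_elim) (simp add: q_def)

section \<open>The iterates and their factorisations\<close>

lemma kernel_K: "kernel_on E K" and kernel_J: "kernel_on E J"
  using forward_K forward_J by (simp_all add: forward_kernel_imp_kernel_on)

lemmas kernel_intros = kernel_K kernel_J kernel_on_comp kernel_on_power

lemma kernel_iter: "kernel_on E (K\<^sub>i n)"
  by (simp add: iter_kernel_def kernel_intros)

lemma iter_0: "z \<in> space E \<Longrightarrow> K\<^sub>i 0 z = K z"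
  by (simp add: iter_kernel_def kernel_comp_return_left kernel_K)

text \<open>Regrouping (KJ)^n (KJ) K as ((KJ)^n K)(JK) isolates the n-th iterate on the left, where
  its bound can be integrated.\<close>

lemma iter_Suc:
  assumes z: "z \<in> space E"
  shows "K\<^sub>i (Suc n) z = kernel_comp E (K\<^sub>i n) JK z"
proof -
  let ?P = "kernel_power E (kernel_comp E K J)"
  have P: "kernel_on E (?P m)" for m
    by (intro kernel_intros)
  have "K\<^sub>i (Suc n) z = kernel_comp E (kernel_comp E (?P n) (kernel_comp E K J)) K z"
    unfolding iter_kernel_def using z
    by (intro kernel_comp_cong kernel_power_Suc2 space_kernel_on[OF P] kernel_intros) simp_all
  also have "\<dots> = kernel_comp E (?P n) KJK z"
    using z by (intro kernel_comp_assoc kernel_intros)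
  also have "\<dots> = kernel_comp E (?P n) (kernel_comp E K JK) z"
    using z by (intro kernel_comp_cong[OF refl space_kernel_on[OF P]])
      (simp_all add: kernel_comp_assoc kernel_intros)
  also have "\<dots> = kernel_comp E (K\<^sub>i n) JK z"
    unfolding iter_kernel_def
    using z by (intro kernel_comp_assoc[symmetric] kernel_intros)
  finally show ?thesis .
qed

text \<open>Regrouping (JK)(JK) as J(KJK) exposes the kernel \<open>KJK\<close> to which the
  hypothesis applies.\<close>

lemma iter_Suc_Suc:
  assumes z: "z \<in> space E"
  shows "K\<^sub>i (Suc (Suc n)) z = kernel_comp E (K\<^sub>i n) (kernel_comp E J KJK) z"
proof -
  have "K\<^sub>i (Suc (Suc n)) z = kernel_comp E (kernel_comp E (K\<^sub>i n) JK) JK z"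
    using z by (subst iter_Suc[OF z], intro kernel_comp_cong[OF iter_Suc space_kernel_on[OF kernel_iter]]) simp_all
  also have "\<dots> = kernel_comp E (K\<^sub>i n) (kernel_comp E JK JK) z"
    using z by (intro kernel_comp_assoc kernel_intros kernel_iter)
  also have "\<dots> = kernel_comp E (K\<^sub>i n) (kernel_comp E J KJK) z"
  proof (rule kernel_comp_cong[OF refl space_kernel_on[OF kernel_iter]])
    show "z \<in> space E" by (rule z)
  next
    fix w assume w: "w \<in> space E"
    have "kernel_comp E JK JK w = kernel_comp E J (kernel_comp E K JK) w"
      using w by (intro kernel_comp_assoc kernel_intros)
    also have "\<dots> = kernel_comp E J KJK w"
      using w by (intro kernel_comp_cong[OF refl space_kernel_on[OF kernel_J]])
        (simp_all add: kernel_comp_assoc kernel_intros)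
    finally show "kernel_comp E JK JK w = kernel_comp E J KJK w" .
  qed
  finally show ?thesis .
qed

lemma forward_iter: "forward_kernel M (K\<^sub>i n)"
proof (induction n)
  case 0
  show ?case
    using forward_K kernel_iter[of 0] iter_0
    by (auto simp: forward_kernel_def space_pair_measure)
next
  case (Suc n)
  have "forward_kernel M (kernel_comp E (K\<^sub>i n) JK)"
    by (intro forward_kernel_comp Suc forward_J forward_K)
  then show ?case
    using kernel_iter[of "Suc n"] iter_Suc
    by (auto simp: forward_kernel_def space_pair_measure)
qed

section \<open>The estimate for consecutive iterates\<close>

text \<open>
  The bound for \<open>KJK\<close> from the later time \<open>fst w'\<close> involves \<open>q (fst w') t\<close>, which need not be
  jointly measurable. By super-additivity it is at most \<open>q s t - q s (fst w)\<close>, which is.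
\<close>

lemma JKJK_add_le:
  assumes w: "w \<in> space E" and sw: "s < fst w" and A: "A \<in> sets E" and c: "0 \<le> c"
  shows "emeasure (kernel_comp E J KJK w) A + ennreal (c + q s (fst w)) * emeasure (JK w) A
    \<le> (\<integral>\<^sup>+ v\<in>A. ennreal (\<eta> + c + q s (fst v)) \<partial>JK w)"
proof -
  let ?u = "fst w"
  let ?f = "\<lambda>v. ennreal (\<eta> + (q s (fst v) - q s ?u)) * indicator A v"
  note JK = kernel_on_comp[OF kernel_J kernel_K]
  have KJK: "kernel_on E KJK" by (intro kernel_intros)
  have f: "?f \<in> borel_measurable E" using A by measurable
  have "emeasure (kernel_comp E J KJK w) A = (\<integral>\<^sup>+ w'. emeasure (KJK w') A \<partial>J w)"
    by (rule emeasure_kernel_comp[OF kernel_J KJK w A])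
  also have "\<dots> \<le> (\<integral>\<^sup>+ w'. \<integral>\<^sup>+ v. ?f v \<partial>K w' \<partial>J w)"
  proof (rule nn_integral_mono_AE)
    show "AE w' in J w. emeasure (KJK w') A \<le> (\<integral>\<^sup>+ v. ?f v \<partial>K w')"
      using AE_forward_kernel[OF forward_J w] AE_space
    proof eventually_elim
      case (elim w')
      then have w': "w' \<in> space E" by (simp add: space_kernel_on[OF kernel_J w])
      have K: "AE v in K w'. fst w' < fst v" by (rule AE_forward_kernel[OF forward_K w'])
      have "emeasure (KJK w') A \<le> weighted (K w') (\<lambda>t. \<eta> + Q (fst w') t) A"
        using KJK_le[of "snd w'" A "fst w'"] w' A by (auto simp: space_pair_measure)
      also have "\<dots> = weighted (K w') (\<lambda>t. \<eta> + q (fst w') t) A"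
        by (rule weighted_q[OF K, of "\<lambda>r. \<eta> + r", symmetric])
      also have "\<dots> \<le> (\<integral>\<^sup>+ v. ?f v \<partial>K w')"
        unfolding weighted_def
      proof (rule nn_integral_mono_AE)
        show "AE v in K w'. ennreal (\<eta> + q (fst w') (fst v)) * indicator A v \<le> ?f v"
          using K
        proof eventually_elim
          case (elim v)
          \<comment> \<open>Two uses of super-additivity: split (u, t) at the time of
            \<open>w'\<close> and drop the nonnegative first term, then split (s, t) at u.\<close>
          then have "q (fst w') (fst v) \<le> q s (fst v) - q s ?u"
            using \<open>?u < fst w'\<close> sw q_superadditive[of s ?u "fst v"]
              q_superadditive[of ?u "fst w'" "fst v"] q_nonneg[of ?u "fst w'"] by simp
          then show ?case
            by (intro mult_right_mono ennreal_leI) auto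
        qed
      qed
      finally show ?case .
    qed
  qed
  \<comment> \<open>The new weight does not depend on \<open>w'\<close>, so the double integral over
    \<open>J\<close> and \<open>K\<close> collapses to one over \<open>JK w\<close>.\<close>
  also have "\<dots> = (\<integral>\<^sup>+ v. ?f v \<partial>JK w)"
    by (rule nn_integral_kernel_comp[OF kernel_J kernel_K w f, symmetric])
  finally have "emeasure (kernel_comp E J KJK w) A + ennreal (c + q s ?u) * emeasure (JK w) A
      \<le> (\<integral>\<^sup>+ v. ?f v \<partial>JK w) + (\<integral>\<^sup>+ v. ennreal (c + q s ?u) * indicator A v \<partial>JK w)"
    using A by (simp add: nn_integral_cmult_indicator add_right_mono)
  also have "\<dots> = (\<integral>\<^sup>+ v. ?f v + ennreal (c + q s ?u) * indicator A v \<partial>JK w)"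
    using A f by (intro nn_integral_add[symmetric] measurable_kernel_on[OF JK w]) auto
  also have "\<dots> \<le> (\<integral>\<^sup>+ v\<in>A. ennreal (\<eta> + c + q s (fst v)) \<partial>JK w)"
  proof (rule nn_integral_mono_AE)
    show "AE v in JK w. ?f v + ennreal (c + q s ?u) * indicator A v
        \<le> ennreal (\<eta> + c + q s (fst v)) * indicator A v"
      using AE_forward_kernel[OF forward_kernel_comp[OF forward_J forward_K] w]
    proof eventually_elim
      case (elim v)
      \<comment> \<open>\<open>ennreal\<close> sends negative reals to 0, so the difference must be
        nonnegative before the weights are added as reals; then \<open>q s ?u\<close> cancels and
        the total no longer depends on \<open>w\<close>.\<close>
      then have "0 \<le> q s (fst v) - q s ?u"
        using q_superadditive[of s ?u "fst v"] sw q_nonneg[of ?u "fst v"] by simp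
      then show ?case
        using \<eta>_nonneg c q_nonneg[of s ?u]
        by (auto simp: indicator_def ennreal_plus[symmetric] simp del: ennreal_plus)
    qed
  qed
  finally show ?thesis .
qed

lemma iter_Suc_le:
  assumes x: "x \<in> space M" and A: "A \<in> sets E"
  shows "emeasure (K\<^sub>i (Suc n) (s, x)) A
    \<le> weighted (K\<^sub>i n (s, x)) (\<lambda>t. \<eta> + q s t / real (Suc n)) A"
  using A
\<comment> \<open>The induction hypothesis is needed for all sets at once, because it is integrated
  against the function \<open>emeasure (JK w) A\<close>.\<close>
proof (induction n arbitrary: A)
  case 0
  let ?z = "(s, x)"
  have z: "?z \<in> space E" using x by (simp add: space_pair_measure)
  have "K\<^sub>i (Suc 0) ?z = kernel_comp E K JK ?z"
    unfolding iter_Suc[OF z]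
    using z by (intro kernel_comp_cong[OF iter_0 space_kernel_on[OF kernel_iter]]) simp_all
  also have "\<dots> = KJK ?z"
    using z by (intro kernel_comp_assoc[symmetric] kernel_intros)
  finally show ?case
    using KJK_le[OF x 0, of s] weighted_q[OF AE_forward_kernel[OF forward_K z], of "\<lambda>r. \<eta> + r" A]
    by (simp add: iter_0[OF z])
next
  case (Suc n)
  let ?z = "(s, x)"
  let ?m = "real (Suc n)" and ?k = "real (Suc (Suc n))"
  have z: "?z \<in> space E" using x by (simp add: space_pair_measure)
  have JK: "kernel_on E JK" and JKJK: "kernel_on E (kernel_comp E J KJK)"
    by (intro kernel_intros)+
  note [measurable] = Suc.prems
  note Ki = kernel_iter[of n] and Ki' = kernel_iter[of "Suc n"]
  note meas_JK = measurable_emeasure_kernel_on[OF JK Suc.prems]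
  note meas_JKJK = measurable_emeasure_kernel_on[OF JKJK Suc.prems]
  let ?X = "emeasure (K\<^sub>i (Suc (Suc n)) ?z) A"
  let ?g = "\<lambda>w. ennreal (?m * \<eta> + q s (fst w)) * emeasure (JK w) A"
  have "?X = (\<integral>\<^sup>+ w. emeasure (JK w) A \<partial>K\<^sub>i (Suc n) ?z)"
    unfolding iter_Suc[OF z, of "Suc n"] by (rule emeasure_kernel_comp[OF Ki' JK z Suc.prems])
  also have "\<dots> \<le> (\<integral>\<^sup>+ w. ennreal (\<eta> + q s (fst w) / ?m) * emeasure (JK w) A \<partial>K\<^sub>i n ?z)"
    using Suc.IH meas_JK
    by (intro nn_integral_le_of_weighted[where M = M] sets_kernel_on[OF kernel_iter z]) simp_all
  finally have "ennreal ?m * ?X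
      \<le> ennreal ?m * (\<integral>\<^sup>+ w. ennreal (\<eta> + q s (fst w) / ?m) * emeasure (JK w) A \<partial>K\<^sub>i n ?z)"
    by (rule mult_left_mono) simp
  also have "\<dots> = (\<integral>\<^sup>+ w. ennreal ?m * (ennreal (\<eta> + q s (fst w) / ?m) * emeasure (JK w) A) \<partial>K\<^sub>i n ?z)"
    using meas_JK
    by (intro nn_integral_cmult[symmetric] measurable_kernel_on[OF Ki z]) simp
  also have "\<dots> = (\<integral>\<^sup>+ w. ?g w \<partial>K\<^sub>i n ?z)"
    by (intro nn_integral_cong ennreal_mult_add_divide q_nonneg \<eta>_nonneg) simp
  finally have m: "ennreal ?m * ?X \<le> (\<integral>\<^sup>+ w. ?g w \<partial>K\<^sub>i n ?z)" .
  \<comment> \<open>Second splitting of the same quantity. One copy of it is added to the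
    \<open>?m\<close> copies bounded above, making \<open>?k\<close> copies.\<close>
  have "?X = (\<integral>\<^sup>+ w. emeasure (kernel_comp E J KJK w) A \<partial>K\<^sub>i n ?z)"
    unfolding iter_Suc_Suc[OF z] by (rule emeasure_kernel_comp[OF Ki JKJK z Suc.prems])
  then have "?X + ennreal ?m * ?X
      \<le> (\<integral>\<^sup>+ w. emeasure (kernel_comp E J KJK w) A \<partial>K\<^sub>i n ?z) + (\<integral>\<^sup>+ w. ?g w \<partial>K\<^sub>i n ?z)"
    using m by (intro add_mono) auto
  also have "\<dots> = (\<integral>\<^sup>+ w. emeasure (kernel_comp E J KJK w) A + ?g w \<partial>K\<^sub>i n ?z)"
    using meas_JK meas_JKJK
    by (intro nn_integral_add[symmetric] measurable_kernel_on[OF Ki z]) simp_all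
  also have "\<dots> \<le> (\<integral>\<^sup>+ w. (\<integral>\<^sup>+ v\<in>A. ennreal (\<eta> + ?m * \<eta> + q s (fst v)) \<partial>JK w) \<partial>K\<^sub>i n ?z)"
  proof (rule nn_integral_mono_AE)
    show "AE w in K\<^sub>i n ?z. emeasure (kernel_comp E J KJK w) A + ?g w
        \<le> (\<integral>\<^sup>+ v\<in>A. ennreal (\<eta> + ?m * \<eta> + q s (fst v)) \<partial>JK w)"
      \<comment> \<open>\<open>JKJK_add_le\<close> is applied with c = \<open>?m * \<eta>\<close>;
        its condition s < \<open>fst w\<close> holds almost everywhere since the iterate is
        forward.\<close>
      using AE_forward_kernel[OF forward_iter z] AE_space
      by eventually_elim
        (use \<eta>_nonneg Suc.prems in \<open>intro JKJK_add_le; simp add: space_kernel_on[OF Ki z]\<close>)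
  qed
  \<comment> \<open>The weight depends only on the final time, so the iterated integral becomes one
    over the next iterate.\<close>
  also have "\<dots> = (\<integral>\<^sup>+ v\<in>A. ennreal (\<eta> + ?m * \<eta> + q s (fst v)) \<partial>K\<^sub>i (Suc n) ?z)"
    unfolding iter_Suc[OF z]
    by (intro nn_integral_kernel_comp[symmetric] Ki JK z) measurable
  also have "\<dots> = (\<integral>\<^sup>+ v. ennreal ?k * (ennreal (\<eta> + q s (fst v) / ?k) * indicator A v)
      \<partial>K\<^sub>i (Suc n) ?z)"
  proof (rule nn_integral_cong)
    fix v :: "real \<times> 'x"
    have "\<eta> + ?m * \<eta> = ?k * \<eta>"
      by (simp add: distrib_right)
    then show "ennreal (\<eta> + ?m * \<eta> + q s (fst v)) * indicator A v
        = ennreal ?k * (ennreal (\<eta> + q s (fst v) / ?k) * indicator A v)"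
      by (simp only: ennreal_mult_add_divide[OF _ \<eta>_nonneg q_nonneg] of_nat_0_less_iff zero_less_Suc)
  qed
  also have "\<dots> = ennreal ?k * weighted (K\<^sub>i (Suc n) ?z) (\<lambda>t. \<eta> + q s t / ?k) A"
    unfolding weighted_def
    by (intro nn_integral_cmult measurable_kernel_on[OF Ki' z]) measurable
  also have "?X + ennreal ?m * ?X = ennreal ?k * ?X"
  proof -
    have "ennreal ?k = 1 + ennreal ?m"
      by (subst of_nat_Suc, subst ennreal_plus) simp_all
    then show ?thesis by (simp only: distrib_right mult_1)
  qed
  finally show ?case
    \<comment> \<open>The factor \<open>?k\<close> is positive and finite, hence can be cancelled
      even if the measures are infinite.\<close>
    by (subst (asm) ennreal_mult_le_mult_iff) simp_all
qed

section \<open>Product bounds and the perturbation series\<close>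

text \<open>Integrating the next factor against the bound for the n-th iterate multiplies the
  weights. Keeping that bound as a premise lets the lemma serve both the induction for the products
  and the second inequality of the theorem.\<close>

lemma weighted_iter_le:
  assumes x: "x \<in> space M" and A: "A \<in> sets E"
    and le: "\<And>B. B \<in> sets E \<Longrightarrow>
      emeasure (K\<^sub>i n (s, x)) B \<le> weighted (K (s, x)) (\<lambda>t. \<Prod>l=1..n. \<eta> + q s t / real l) B"
  shows "weighted (K\<^sub>i n (s, x)) (\<lambda>t. \<eta> + q s t / real (Suc n)) A
    \<le> weighted (K (s, x)) (\<lambda>t. \<Prod>l=1..Suc n. \<eta> + q s t / real l) A"
proof -
  let ?z = "(s, x)"
  let ?p = "\<lambda>n t. \<Prod>l=1..n. \<eta> + q s t / real l"
  have z: "?z \<in> space E" using x by (simp add: space_pair_measure)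
  have "weighted (K\<^sub>i n ?z) (\<lambda>t. \<eta> + q s t / real (Suc n)) A
      \<le> (\<integral>\<^sup>+ w. ennreal (?p n (fst w)) *
          (ennreal (\<eta> + q s (fst w) / real (Suc n)) * indicator A w) \<partial>K ?z)"
    unfolding weighted_def
    using le A
    by (intro nn_integral_le_of_weighted[where M = M] sets_kernel_on[OF _ z] kernel_iter kernel_K)
      simp_all
  also have "\<dots> = weighted (K ?z) (?p (Suc n)) A"
    unfolding weighted_def using q_nonneg \<eta>_nonneg
    by (intro nn_integral_cong)
      (simp add: mult.assoc[symmetric] ennreal_mult[symmetric] prod_nonneg del: ennreal_plus)
  finally show ?thesis .
qed

lemma iter_le_prod:
  assumes x: "x \<in> space M" and A: "A \<in> sets E"
  shows "emeasure (K\<^sub>i n (s, x)) A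
    \<le> weighted (K (s, x)) (\<lambda>t. \<Prod>l=1..n. \<eta> + q s t / real l) A"
  using A
proof (induction n arbitrary: A)
  case 0
  have z: "(s, x) \<in> space E" using x by (simp add: space_pair_measure)
  then show ?case
    using 0 by (simp add: weighted_def iter_0 nn_integral_indicator sets_kernel_on[OF kernel_K])
next
  case (Suc n)
  show ?case
    using iter_Suc_le[OF x Suc.prems] weighted_iter_le[OF x Suc.prems Suc.IH] by (rule order_trans)
qed

text \<open>All terms are nonnegative, so the product bounds can be summed under the integral.
  Leaving the sum G abstract covers the exponential and the binomial case together.\<close>

lemma suminf_iter_le:
  assumes x: "x \<in> space M" and A [measurable]: "A \<in> sets E"
    and G: "\<And>y. 0 \<le> y \<Longrightarrow> (\<lambda>n. \<Prod>l=1..n. \<eta> + y / real l) sums G y"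
  shows "emeasure (kernel_suminf E K\<^sub>i (s, x)) A \<le> weighted (K (s, x)) (\<lambda>t. G (Q s t)) A"
proof -
  let ?z = "(s, x)"
  let ?p = "\<lambda>n t. \<Prod>l=1..n. \<eta> + q s t / real l"
  have z: "?z \<in> space E" using x by (simp add: space_pair_measure)
  have p_nonneg: "0 \<le> ?p n t" for n t
    using q_nonneg \<eta>_nonneg by (intro prod_nonneg) simp
  have "emeasure (kernel_suminf E K\<^sub>i ?z) A = (\<Sum>n. emeasure (K\<^sub>i n ?z) A)"
    by (rule emeasure_kernel_suminf[OF kernel_iter z A])
  also have "\<dots> \<le> (\<Sum>n. weighted (K ?z) (?p n) A)"
    by (intro suminf_le iter_le_prod x A) simp_all
  also have "\<dots> = (\<integral>\<^sup>+ w. (\<Sum>n. ennreal (?p n (fst w)) * indicator A w) \<partial>K ?z)"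
    unfolding weighted_def
    by (intro nn_integral_suminf[symmetric] measurable_kernel_on[OF kernel_K z]) measurable
  also have "\<dots> = weighted (K ?z) (\<lambda>t. G (q s t)) A"
    unfolding weighted_def
  proof (intro nn_integral_cong)
    fix w :: "real \<times> 'x"
    have "(\<Sum>n. ennreal (?p n (fst w))) = ennreal (G (q s (fst w)))"
      by (intro suminf_ennreal_eq p_nonneg G q_nonneg)
    then show "(\<Sum>n. ennreal (?p n (fst w)) * indicator A w)
        = ennreal (G (q s (fst w))) * indicator A w"
      by simp
  qed
  also have "\<dots> = weighted (K ?z) (\<lambda>t. G (Q s t)) A"
    using AE_forward_kernel[OF forward_K z] by (intro weighted_q) simp
  finally show ?thesis .
qed

end

section \<open>Transfer of the estimates from the truncation to Q\<close>

theorem theorem2p2: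
  fixes M :: "'x measure"
    and K J :: "real \<times> 'x \<Rightarrow> (real \<times> 'x) measure"
    and \<eta> :: real
    and Q :: "real \<Rightarrow> real \<Rightarrow> real"
  assumes "forward_kernel M K" and "forward_kernel M J"
    and "0 \<le> \<eta>"
    and "\<And>u v. 0 \<le> Q u v" and "superadditive Q"
    and "\<And>s x A. x \<in> space M \<Longrightarrow> A \<in> sets (spacetime M) \<Longrightarrow>
           emeasure (kernel_comp (spacetime M) (kernel_comp (spacetime M) K J) K (s, x)) A
             \<le> weighted (K (s, x)) (\<lambda>t. \<eta> + Q s t) A"
  shows "(\<forall>n\<ge>1. \<forall>s. \<forall>x\<in>space M. \<forall>A\<in>sets (spacetime M).
            emeasure (iter_kernel M K J n (s, x)) A
              \<le> weighted (iter_kernel M K J (n - 1) (s, x)) (\<lambda>t. \<eta> + Q s t / real n) A \<and>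
            weighted (iter_kernel M K J (n - 1) (s, x)) (\<lambda>t. \<eta> + Q s t / real n) A
              \<le> weighted (K (s, x)) (\<lambda>t. \<Prod>l=1..n. \<eta> + Q s t / real l) A) \<and>
         (0 < \<eta> \<and> \<eta> < 1 \<longrightarrow>
            (\<forall>s. \<forall>x\<in>space M. \<forall>A\<in>sets (spacetime M).
               emeasure (kernel_suminf (spacetime M) (iter_kernel M K J) (s, x)) A
                 \<le> weighted (K (s, x)) (\<lambda>t. (1 / (1 - \<eta>)) powr (1 + Q s t / \<eta>)) A)) \<and>
         (\<eta> = 0 \<longrightarrow>
            (\<forall>s. \<forall>x\<in>space M. \<forall>A\<in>sets (spacetime M).
               emeasure (kernel_suminf (spacetime M) (iter_kernel M K J) (s, x)) A
                 \<le> weighted (K (s, x)) (\<lambda>t. exp (Q s t)) A))"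
proof -
  interpret kernel_perturbation M K J \<eta> Q
    using assms by unfold_locales
  show ?thesis
  proof (intro conjI allI ballI impI)
    fix n :: nat and s x A
    assume "1 \<le> n" and x: "x \<in> space M" and A: "A \<in> sets E"
    then obtain m where n: "n = Suc m"
      by (cases n) auto
    have z: "(s, x) \<in> space E" using x by (simp add: space_pair_measure)
    \<comment> \<open>The m-th iterate and \<open>K\<close> both charge only times after s, so
      \<open>weighted_q\<close> restores Q in the weights against either measure.\<close>
    note AE = AE_forward_kernel[OF forward_iter[of m] z, simplified]
    note AE_K = AE_forward_kernel[OF forward_K z, simplified]
    show "emeasure (iter_kernel M K J n (s, x)) A
        \<le> weighted (iter_kernel M K J (n - 1) (s, x)) (\<lambda>t. \<eta> + Q s t / real n) A"
      using iter_Suc_le[OF x A, of m s] weighted_q[OF AE, where F = "\<lambda>r. \<eta> + r / real n"]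
      by (simp add: n)
    show "weighted (iter_kernel M K J (n - 1) (s, x)) (\<lambda>t. \<eta> + Q s t / real n) A
        \<le> weighted (K (s, x)) (\<lambda>t. \<Prod>l=1..n. \<eta> + Q s t / real l) A"
      using weighted_iter_le[OF x A iter_le_prod[OF x], of m s]
        weighted_q[OF AE, where F = "\<lambda>r. \<eta> + r / real n"]
        weighted_q[OF AE_K, where F = "\<lambda>r. \<Prod>l=1..n. \<eta> + r / real l"]
      by (simp add: n)
  next
    fix s x A
    assume "0 < \<eta> \<and> \<eta> < 1" and "x \<in> space M" and "A \<in> sets E"
    then show "emeasure (kernel_suminf E K\<^sub>i (s, x)) A
        \<le> weighted (K (s, x)) (\<lambda>t. (1 / (1 - \<eta>)) powr (1 + Q s t / \<eta>)) A"
      by (intro suminf_iter_le sums_prod_div_powr) simp_all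
  next
    fix s x A
    assume "\<eta> = 0" and "x \<in> space M" and "A \<in> sets E"
    then show "emeasure (kernel_suminf E K\<^sub>i (s, x)) A \<le> weighted (K (s, x)) (\<lambda>t. exp (Q s t)) A"
      by (intro suminf_iter_le) (use sums_prod_div_exp in simp_all)
  qed
qed

end
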